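(* Let $M\ge1$, and let $\mathcal{R}$ be the recurrence region of the $M$-user single-packet Aloha network defined in the context. For $\underline{p}=(p_1,\ldots,p_M)\in(0,1)^M$ define $$\mathcal{C}_1(\underline{p})=\Big\{(\lambda_1,\ldots,\lambda_M)\in(0,1)^M:\ \sum_{i=1}^M\frac{\lambda_i}{p_i\prod_{j\ne i}(1-p_j)}<1\Big\},$$ $$\mathcal{C}_2(\underline{p})=\Big\{(\lambda_1,\ldots,\lambda_M)\in(0,1)^M:\ \lambda_i<p_i\prod_{j\ne i}(1-p_j)\text{ for some }1\le i\le M\Big\},$$ and let $\mathcal{C}_1=\bigcup_{\underline{p}\in(0,1)^M}\mathcal{C}_1(\underline{p})$ and $\mathcal{C}_2=\bigcup_{\underline{p}\in(0,1)^M}\mathcal{C}_2(\underline{p})$. Then $$\mathcal{C}_1\subseteq\mathcal{R}\subseteq \mathrm{cl}(\mathcal{C}_2),$$ where $\mathrm{cl}(\mathcal{C}_2)$ is the closure of $\mathcal{C}_2$ in $\mathbb{R}^M$.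
   Context: Model. Let $M\ge 1$ be an integer (number of users). For each $1\le i\le M$: - $\{A_i(n)\}_{n\ge1}$ are i.i.d. nonnegative integer valued random variables (packets arriving at user $i$ in time slot $n$) with finite mean $\lambda_i=\mathbb{E}A_i(n)$ and $\mathbb{P}(A_i(n)=1)>0$. - $\{W_i(n)\}_{n\ge1}$ are i.i.d. $\{0,1\}$-valued random variables with $p_i=\mathbb{P}(W_i(n)=1)=1-\mathbb{P}(W_i(n)=0)$, $p_i\in(0,1)$. The $2M$ sequences $\{A_i(n)\}_{n\ge1}$, $\{W_i(n)\}_{n\ge1}$, $1\le i\le M$, are mutually independent, and independent of the initial state $\underline{Q}(0)$. The queue lengths $Q_i(n)\in\{0,1,2,\ldots\}$ evolve for $n\ge0$ by $$Q_i(n+1)=Q_i(n)+A_i(n+1)-\min(Q_i(n),W_i(n+1))\,\mathbf{1}\Big(B_i(n+1)\cap\bigcap_{j\ne i}B_j^c(n+1)\Big),$$ where $B_i(n+1)=\{Q_i(n)\ge1\}\cap\{W_i(n+1)\ge1\}$, $B_j^c$ is the complement of $B_j$, and $\mathbf{1}(\cdot)$ is the indicator function. For $\underline{p}=(p_1,\ldots,p_M)\in(0,1)^M$, the resulting time-homogeneous Markov chain on $\{0,1,2,\ldots\}^M$ is written $\underline{Q}(\underline{p},n)=(Q_1(n),\ldots,Q_M(n))$. Empty products equal $1$. Positive recurrence is understood via the origin: with $\underline{Q}(\underline{p},0)=(0,\ldots,0)$ and $T=\inf\{k\ge1: Q_i(k)=0\text{ for all }1\le i\le M\}$ (with $\inf\emptyset=\infty$),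 the chain is positive recurrent if $\mathbb{E}T<\infty$. Recurrence region. For each mean vector $(\lambda_1,\ldots,\lambda_M)\in(0,\infty)^M$ for which they exist, let arrival distributions with these means, supported on the nonnegative integers and satisfying $\mathbb{P}(A_i(n)=1)>0$ for every $1\le i\le M$, be given (an arbitrary fixed choice, not depending on $\underline{p}$). Then $$\mathcal{R}=\big\{(\lambda_1,\ldots,\lambda_M):\ \exists\,\underline{p}\in(0,1)^M\text{ such that }\{\underline{Q}(\underline{p},n)\}_{n\ge1}\text{ is positive recurrent}\big\}.$$ *)

theory Defs
  imports "HOL-Probability.Probability"
begin

definition unit_cube :: "(real ^ 'm::finite) set" where
  "unit_cube = {x. \<forall>i. 0 < x $ i \<and> x $ i < 1}"

definition arrival_laws :: "real ^ 'm::finite \<Rightarrow> ('m \<Rightarrow> nat pmf) \<Rightarrow> bool" where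
  "arrival_laws lam d \<longleftrightarrow>
     (\<forall>i. integrable (measure_pmf (d i)) real \<and>
          measure_pmf.expectation (d i) real = lam $ i \<and>
          pmf (d i) 1 > 0)"

definition admissible_mean :: "real ^ 'm::finite \<Rightarrow> bool" where
  "admissible_mean lam \<longleftrightarrow> (\<forall>i. 0 < lam $ i) \<and> (\<exists>d. arrival_laws lam d)"

text \<open>
  The variables driving one network live on the probability space \<open>M\<close>: \<open>A i n\<close> and \<open>W i n\<close> are
  the arrivals to user \<open>i\<close> and its transmission coin in slot \<open>n \<ge> 1\<close>; values at \<open>n = 0\<close> are unused.
  That each of these sequences is i.i.d. and that all the sequences are mutually independent is
  expressed as independence of the whole doubly indexed family, together with the marginal laws.
\<close>

locale aloha_inputs = prob_space M
  for M :: "'w measure"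
  and A W :: "'m::finite \<Rightarrow> nat \<Rightarrow> 'w \<Rightarrow> nat"
  and d :: "'m \<Rightarrow> nat pmf"
  and p :: "real ^ 'm" +
  assumes indep:
    "indep_vars (\<lambda>_. count_space UNIV)
       (case_sum (\<lambda>(i, n). A i n) (\<lambda>(i, n). W i n))
       ((UNIV \<times> {1..}) <+> (UNIV \<times> {1..}))"
  and A_law: "\<And>i n. 1 \<le> n \<Longrightarrow> distr M (count_space UNIV) (A i n) = measure_pmf (d i)"
  and W_range: "\<And>i n \<omega>. 1 \<le> n \<Longrightarrow> \<omega> \<in> space M \<Longrightarrow> W i n \<omega> \<in> {0, 1}"
  and W_law: "\<And>i n. 1 \<le> n \<Longrightarrow> prob {\<omega> \<in> space M. W i n \<omega> = 1} = p $ i"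

definition attempts :: "('m \<Rightarrow> nat) \<Rightarrow> ('m \<Rightarrow> nat) \<Rightarrow> 'm \<Rightarrow> bool" where
  "attempts q w i \<longleftrightarrow> 1 \<le> q i \<and> 1 \<le> w i"

text \<open>The subtraction on natural numbers never truncates, since \<open>min (q i) (w i) \<le> q i\<close>.\<close>

definition aloha_step ::
  "('m \<Rightarrow> nat) \<Rightarrow> ('m \<Rightarrow> nat) \<Rightarrow> ('m \<Rightarrow> nat) \<Rightarrow> 'm \<Rightarrow> nat" where
  "aloha_step a w q i =
     q i + a i - min (q i) (w i) * of_bool (attempts q w i \<and> (\<forall>j. j \<noteq> i \<longrightarrow> \<not> attempts q w j))"

primrec queue ::
  "('m \<Rightarrow> nat \<Rightarrow> 'w \<Rightarrow> nat) \<Rightarrow> ('m \<Rightarrow> nat \<Rightarrow> 'w \<Rightarrow> nat) \<Rightarrow> ('w \<Rightarrow> 'm \<Rightarrow> nat) \<Rightarrow>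
    nat \<Rightarrow> 'w \<Rightarrow> 'm \<Rightarrow> nat" where
  "queue A W Q0 0 \<omega> = Q0 \<omega>"
| "queue A W Q0 (Suc n) \<omega> =
     aloha_step (\<lambda>i. A i (Suc n) \<omega>) (\<lambda>i. W i (Suc n) \<omega>) (queue A W Q0 n \<omega>)"

text \<open>The infimum of the empty set in \<^typ>\<open>ennreal\<close> is \<open>\<infinity>\<close>.\<close>

definition return_time ::
  "('m \<Rightarrow> nat \<Rightarrow> 'w \<Rightarrow> nat) \<Rightarrow> ('m \<Rightarrow> nat \<Rightarrow> 'w \<Rightarrow> nat) \<Rightarrow> 'w \<Rightarrow> ennreal" where
  "return_time A W \<omega> =
     Inf {of_nat k | k. 1 \<le> k \<and> (\<forall>i. queue A W (\<lambda>_ _. 0) k \<omega> i = 0)}"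

definition positive_recurrent ::
  "'w measure \<Rightarrow> ('m \<Rightarrow> nat \<Rightarrow> 'w \<Rightarrow> nat) \<Rightarrow> ('m \<Rightarrow> nat \<Rightarrow> 'w \<Rightarrow> nat) \<Rightarrow> bool" where
  "positive_recurrent M A W \<longleftrightarrow> (\<integral>\<^sup>+ \<omega>. return_time A W \<omega> \<partial>M) < \<infinity>"

text \<open>\<open>M lam p\<close>, \<open>A lam p\<close>, \<open>W lam p\<close> realise the network with mean vector \<open>lam\<close> and
  transmission probabilities \<open>p\<close>.\<close>

definition recurrence_region ::
  "(real ^ 'm::finite \<Rightarrow> real ^ 'm \<Rightarrow> 'w measure) \<Rightarrow>
   (real ^ 'm \<Rightarrow> real ^ 'm \<Rightarrow> 'm \<Rightarrow> nat \<Rightarrow> 'w \<Rightarrow> nat) \<Rightarrow>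
   (real ^ 'm \<Rightarrow> real ^ 'm \<Rightarrow> 'm \<Rightarrow> nat \<Rightarrow> 'w \<Rightarrow> nat) \<Rightarrow> (real ^ 'm) set" where
  "recurrence_region M A W =
     {lam. admissible_mean lam \<and>
           (\<exists>p\<in>unit_cube. positive_recurrent (M lam p) (A lam p) (W lam p))}"

definition success_rate :: "real ^ 'm::finite \<Rightarrow> 'm \<Rightarrow> real" where
  "success_rate p i = p $ i * (\<Prod>j\<in>UNIV - {i}. 1 - p $ j)"

definition C1_at :: "real ^ 'm::finite \<Rightarrow> (real ^ 'm) set" where
  "C1_at p = {lam \<in> unit_cube. (\<Sum>i\<in>UNIV. lam $ i / success_rate p i) < 1}"

definition C2_at :: "real ^ 'm::finite \<Rightarrow> (real ^ 'm) set" where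
  "C2_at p = {lam \<in> unit_cube. \<exists>i. lam $ i < success_rate p i}"

definition C1 :: "(real ^ 'm::finite) set" where
  "C1 = (\<Union>p\<in>unit_cube. C1_at p)"

definition C2 :: "(real ^ 'm::finite) set" where
  "C2 = (\<Union>p\<in>unit_cube. C2_at p)"

end

theory Submission imports Defs begin

text \<open>
  Start the network empty and write \<open>b n\<close> for the probability that it has not returned to the origin in
  slots \<open>1, \<dots>, n\<close>. The expected return time is \<open>\<Sum>n. b n\<close>, so both inclusions are statements about
  this series (\<open>expected_return_time\<close>).

  For the inner bound, weigh queue \<open>i\<close> by the reciprocal of \<open>s i = p i * (\<Prod>j \<noteq> i. 1 - p j)\<close>. A nonempty
  queue \<open>i\<close> transmits successfully with probability at least \<open>s i\<close>, because silence of all other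
  users suffices for success, whatever their queues hold. Hence each nonempty queue lowers the weighted
  sum \<open>V\<close> of the queue lengths by at least \<open>1\<close> per slot on average, while the arrivals raise it by
  \<open>\<rho> = (\<Sum>i. lam i / s i)\<close>. Away from the origin at least one queue is nonempty, so the drift of \<open>V\<close> is at
  most \<open>\<rho> - 1 < 0\<close> at every state but the origin. Since \<open>V \<ge> 0\<close>, summing the drift over the slots before
  the return bounds \<open>\<Sum>n. b n\<close> by \<open>1 / (1 - \<rho>)\<close> (\<open>sum_prob_busy_le\<close>).

  For the outer bound, \<open>C2\<close> is the whole open unit cube: if user \<open>i\<close> transmits almost always and the
  others almost never, then \<open>s i\<close> is close to \<open>1\<close> (\<open>C2_eq_unit_cube\<close>). It remains to see that
  positive recurrence forces \<open>lam i \<le> 1\<close>, since the vectors with entries in \<open>(0, 1]\<close> are limits of points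
  of the cube. Queue \<open>i\<close> loses at most one packet per slot and is empty at the return time \<open>T\<close>, so at most
  \<open>T\<close> packets arrived up to then. By Wald's identity their expected number is \<open>lam i * E T\<close>; thus
  \<open>lam i * E T \<le> E T\<close> with \<open>1 \<le> E T < \<infinity>\<close> (\<open>mean_le_1_if_positive_recurrent\<close>).

  Both parts use that what happened up to slot \<open>n\<close> is independent of the input of slot \<open>n + 1\<close>
  (\<open>indep_past_slot\<close>).
\<close>

section \<open>One slot\<close>

definition success :: "('m \<Rightarrow> nat) \<Rightarrow> ('m \<Rightarrow> nat) \<Rightarrow> 'm \<Rightarrow> bool" where
  "success q w i \<longleftrightarrow> attempts q w i \<and> (\<forall>j. j \<noteq> i \<longrightarrow> \<not> attempts q w j)"

text \<open>
  Conservation of packets, stated additively so that truncated subtraction does not reach the later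
  arguments.
\<close>

lemma aloha_step_balance:
  assumes "w i \<le> 1"
  shows "aloha_step a w q i + of_bool (success q w i) = q i + a i"
proof (cases "success q w i")
  case True
  then have "w i = 1" "1 \<le> q i"
    using assms by (auto simp: success_def attempts_def)
  with True show ?thesis
    by (simp add: aloha_step_def success_def[symmetric])
qed (simp add: aloha_step_def success_def[symmetric])

section \<open>The queues and the busy period as functions of the input\<close>

abbreviation queue0 where
  "queue0 A W \<equiv> queue A W (\<lambda>_ _. 0)"

text \<open>
  The event \<open>n < T\<close> for the return time \<open>T\<close>, in a form that shows that it is decided by the first \<open>n\<close> slots.
\<close>

definition busy ::
  "('m \<Rightarrow> nat \<Rightarrow> 'w \<Rightarrow> nat) \<Rightarrow> ('m \<Rightarrow> nat \<Rightarrow> 'w \<Rightarrow> nat) \<Rightarrow> nat \<Rightarrow> 'w \<Rightarrow> bool" where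
  "busy A W n \<omega> \<longleftrightarrow> (\<forall>k\<in>{1..n}. \<exists>i. queue0 A W k \<omega> i \<noteq> 0)"

lemma busy_0: "busy A W 0 \<omega>"
  by (simp add: busy_def)

lemma busy_Suc: "busy A W (Suc n) \<omega> \<longleftrightarrow> busy A W n \<omega> \<and> (\<exists>i. queue0 A W (Suc n) \<omega> i \<noteq> 0)"
proof -
  have "(\<forall>k\<in>{1..Suc n}. P k) \<longleftrightarrow> (\<forall>k\<in>{1..n}. P k) \<and> P (Suc n)" for P
    by (auto simp: Ball_def le_Suc_eq)
  then show ?thesis
    unfolding busy_def .
qed

lemma busy_nonzero: "busy A W n \<omega> \<Longrightarrow> 1 \<le> n \<Longrightarrow> \<exists>i. queue0 A W n \<omega> i \<noteq> 0"
  by (cases n) (auto simp: busy_Suc simp del: queue.simps)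

text \<open>
  The queue lengths together with the truth value of \<open>busy\<close> form a process driven by one slot of input at
  a time. Its values, like those of \<open>slot\<close>, lie in a countable type because there are finitely many
  users, so measurability reduces to singletons.
\<close>

definition snapshot ::
  "('m \<Rightarrow> nat \<Rightarrow> 'w \<Rightarrow> nat) \<Rightarrow> ('m \<Rightarrow> nat \<Rightarrow> 'w \<Rightarrow> nat) \<Rightarrow> nat \<Rightarrow> 'w \<Rightarrow> ('m \<Rightarrow> nat) \<times> bool" where
  "snapshot A W n \<omega> = (queue0 A W n \<omega>, busy A W n \<omega>)"

definition slot ::
  "('m \<Rightarrow> nat \<Rightarrow> 'w \<Rightarrow> nat) \<Rightarrow> ('m \<Rightarrow> nat \<Rightarrow> 'w \<Rightarrow> nat) \<Rightarrow> nat \<Rightarrow> 'w \<Rightarrow> ('m \<Rightarrow> nat) \<times> ('m \<Rightarrow> nat)" where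
  "slot A W n \<omega> = (\<lambda>i. A i n \<omega>, \<lambda>i. W i n \<omega>)"

definition snapshot_step ::
  "('m \<Rightarrow> nat) \<times> bool \<Rightarrow> ('m \<Rightarrow> nat) \<times> ('m \<Rightarrow> nat) \<Rightarrow> ('m \<Rightarrow> nat) \<times> bool" where
  "snapshot_step z s =
     (let q = aloha_step (fst s) (snd s) (fst z) in (q, snd z \<and> (\<exists>i. q i \<noteq> 0)))"

lemma snapshot_0: "snapshot A W 0 \<omega> = (\<lambda>_. 0, True)"
  by (simp add: snapshot_def busy_0)

lemma snapshot_Suc:
  "snapshot A W (Suc n) \<omega> = snapshot_step (snapshot A W n \<omega>) (slot A W (Suc n) \<omega>)"
  by (simp add: snapshot_def snapshot_step_def busy_Suc slot_def Let_def)

text \<open>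
  The past is a function of the input of the past slots alone. In the proof of independence this
  replaces the given input by coordinate functions on a product space.
\<close>

lemma snapshot_cong:
  assumes "\<And>k. 1 \<le> k \<Longrightarrow> k \<le> n \<Longrightarrow> slot A W k \<omega> = slot A' W' k \<omega>'"
  shows "snapshot A W n \<omega> = snapshot A' W' n \<omega>'"
  using assms
proof (induction n)
  case (Suc n)
  have "snapshot A W n \<omega> = snapshot A' W' n \<omega>'"
    by (rule Suc.IH) (simp add: Suc.prems)
  moreover have "slot A W (Suc n) \<omega> = slot A' W' (Suc n) \<omega>'"
    by (rule Suc.prems) simp_all
  ultimately show ?case
    by (simp only: snapshot_Suc)
qed (simp add: snapshot_0)

lemma measurable_fun_count_space:
  fixes f :: "'x \<Rightarrow> 'm::finite \<Rightarrow> nat"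
  assumes "\<And>i. (\<lambda>x. f x i) \<in> N \<rightarrow>\<^sub>M count_space UNIV"
  shows "f \<in> N \<rightarrow>\<^sub>M count_space UNIV"
proof -
  have "f -` {q} \<inter> space N \<in> sets N" for q
  proof -
    have "f -` {q} \<inter> space N = (\<Inter>i. (\<lambda>x. f x i) -` {q i} \<inter> space N)"
      by auto
    also have "\<dots> \<in> sets N"
      by (intro sets.finite_INT measurable_sets[OF assms]) auto
    finally show ?thesis .
  qed
  then show ?thesis
    by (simp add: measurable_count_space_eq2_countable)
qed

lemma measurable_pair_count_space:
  fixes f :: "'x \<Rightarrow> 'a::countable" and g :: "'x \<Rightarrow> 'b::countable"
  assumes "f \<in> N \<rightarrow>\<^sub>M count_space UNIV" "g \<in> N \<rightarrow>\<^sub>M count_space UNIV"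
  shows "(\<lambda>x. h (f x) (g x)) \<in> N \<rightarrow>\<^sub>M count_space UNIV"
proof (rule measurable_compose_countable[where f = "\<lambda>b x. h (f x) b", OF _ assms(2)])
  show "(\<lambda>x. h (f x) b) \<in> N \<rightarrow>\<^sub>M count_space UNIV" for b
    by (rule measurable_compose[OF assms(1), of "\<lambda>a. h a b"]) simp
qed

lemma measurable_slot:
  fixes A W :: "'m::finite \<Rightarrow> nat \<Rightarrow> 'x \<Rightarrow> nat"
  assumes "\<And>i. A i n \<in> N \<rightarrow>\<^sub>M count_space UNIV" "\<And>i. W i n \<in> N \<rightarrow>\<^sub>M count_space UNIV"
  shows "slot A W n \<in> N \<rightarrow>\<^sub>M count_space UNIV"
  unfolding slot_def by (rule measurable_pair_count_space[where h = Pair]; rule measurable_fun_count_space; rule assms)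

lemma measurable_snapshot:
  fixes A W :: "'m::finite \<Rightarrow> nat \<Rightarrow> 'x \<Rightarrow> nat"
  assumes "\<And>i k. 1 \<le> k \<Longrightarrow> k \<le> n \<Longrightarrow> A i k \<in> N \<rightarrow>\<^sub>M count_space UNIV"
    and "\<And>i k. 1 \<le> k \<Longrightarrow> k \<le> n \<Longrightarrow> W i k \<in> N \<rightarrow>\<^sub>M count_space UNIV"
  shows "snapshot A W n \<in> N \<rightarrow>\<^sub>M count_space UNIV"
  using assms
proof (induction n)
  case 0
  show ?case by (simp add: snapshot_0[abs_def])
next
  case (Suc n)
  have "(\<lambda>x. snapshot_step (snapshot A W n x) (slot A W (Suc n) x)) \<in> N \<rightarrow>\<^sub>M count_space UNIV"
  proof (rule measurable_pair_count_space[where h = snapshot_step])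
    show "snapshot A W n \<in> N \<rightarrow>\<^sub>M count_space UNIV"
      by (rule Suc.IH) (simp_all add: Suc.prems)
    show "slot A W (Suc n) \<in> N \<rightarrow>\<^sub>M count_space UNIV"
      by (rule measurable_slot) (simp_all add: Suc.prems)
  qed
  then show ?case by (simp add: snapshot_Suc[abs_def])
qed

section \<open>Return time and busy period\<close>

lemma busy_mono: "busy A W n \<omega> \<Longrightarrow> k \<le> n \<Longrightarrow> busy A W k \<omega>"
  by (auto simp: busy_def)

text \<open>
  When \<open>busy\<close> fails at some time, the return time is finite, and \<open>t\<close> is its value.
\<close>

lemma busy_until:
  assumes "\<not> busy A W n \<omega>"
  shows "\<exists>t\<ge>1. (\<forall>i. queue0 A W t \<omega> i = 0) \<and> (\<forall>k. busy A W k \<omega> \<longleftrightarrow> k < t)"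
proof -
  define t where "t = (LEAST k. \<not> busy A W k \<omega>)"
  have t: "\<not> busy A W t \<omega>"
    unfolding t_def using assms by (rule LeastI)
  have before: "busy A W k \<omega>" if "k < t" for k
    using not_less_Least[of k "\<lambda>k. \<not> busy A W k \<omega>"] that by (simp add: t_def)
  have after: "\<not> busy A W k \<omega>" if "t \<le> k" for k
    using busy_mono[OF _ that, of A W \<omega>] t by blast
  from t obtain s where s: "t = Suc s"
    by (cases t) (auto simp: busy_0)
  with t before[of s] have "queue0 A W t \<omega> i = 0" for i
    by (simp add: busy_Suc del: queue.simps)
  moreover have "busy A W k \<omega> \<longleftrightarrow> k < t" for k
    using before[of k] after[of k] by linarith
  ultimately show ?thesis
    using s by (intro exI[of _ t]) simp
qed

text \<open>
  A number \<open>T\<close> in \<open>{1, 2, \<dots>, \<infinity>}\<close> is the number of \<open>n \<ge> 0\<close> with \<open>n < T\<close>.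
\<close>

lemma return_time_eq_suminf:
  "return_time A W \<omega> = (\<Sum>n. of_bool (busy A W n \<omega>))"
proof (cases "\<forall>n. busy A W n \<omega>")
  case True
  have empty: "{of_nat k |k. 1 \<le> k \<and> (\<forall>i. queue0 A W k \<omega> i = 0)} = ({} :: ennreal set)"
  proof (rule ccontr)
    assume "\<not> ?thesis"
    then obtain k where "1 \<le> k" "\<forall>i. queue0 A W k \<omega> i = 0"
      by blast
    with busy_nonzero[of A W k \<omega>] True show False
      by simp
  qed
  have "return_time A W \<omega> = \<infinity>"
    unfolding return_time_def empty by simp
  then show ?thesis
    using True by (simp add: suminf_eq_SUP ennreal_SUP_of_nat_eq_top)
next
  case False
  then obtain n where "\<not> busy A W n \<omega>"
    by blast
  from busy_until[OF this] obtain t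
    where t: "1 \<le> t" "\<forall>i. queue0 A W t \<omega> i = 0" "\<And>k. busy A W k \<omega> \<longleftrightarrow> k < t"
    by blast
  have least: "t \<le> k" if "1 \<le> k" "\<forall>i. queue0 A W k \<omega> i = 0" for k
  proof (rule ccontr)
    assume "\<not> t \<le> k"
    then have "busy A W k \<omega>"
      using t(3) by simp
    with busy_nonzero[of A W k \<omega>] that show False
      by simp
  qed
  have "return_time A W \<omega> = of_nat t"
    unfolding return_time_def
  proof (rule antisym)
    show "Inf {of_nat k |k. 1 \<le> k \<and> (\<forall>i. queue0 A W k \<omega> i = 0)} \<le> (of_nat t :: ennreal)"
      using t(1,2) by (intro Inf_lower) blast
    show "(of_nat t :: ennreal) \<le> Inf {of_nat k |k. 1 \<le> k \<and> (\<forall>i. queue0 A W k \<omega> i = 0)}"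
    proof (rule Inf_greatest)
      fix x :: ennreal
      assume "x \<in> {of_nat k |k. 1 \<le> k \<and> (\<forall>i. queue0 A W k \<omega> i = 0)}"
      then obtain k where "x = of_nat k" "1 \<le> k" "\<forall>i. queue0 A W k \<omega> i = 0"
        by blast
      with least show "of_nat t \<le> x"
        by (simp only: of_nat_le_iff)
    qed
  qed
  also have "\<dots> = (\<Sum>n<t. of_bool (busy A W n \<omega>))"
    by (simp only: t(3)) simp
  also have "\<dots> = (\<Sum>n. of_bool (busy A W n \<omega>))"
    by (rule suminf_finite[symmetric]) (simp_all only: t(3), simp_all)
  finally show ?thesis .
qed

section \<open>Independence of the past and the next slot\<close>

context aloha_inputs
begin

lemma measurable_inputs:
  assumes "1 \<le> n"
  shows "A i n \<in> M \<rightarrow>\<^sub>M count_space UNIV" "W i n \<in> M \<rightarrow>\<^sub>M count_space UNIV"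
proof -
  have X: "case_sum (\<lambda>(i, n). A i n) (\<lambda>(i, n). W i n) j \<in> M \<rightarrow>\<^sub>M count_space UNIV"
    if "j \<in> (UNIV \<times> {1..}) <+> (UNIV \<times> {1..})" for j
    using indep that by (simp only: indep_vars_def)
  show "A i n \<in> M \<rightarrow>\<^sub>M count_space UNIV"
    using X[of "Inl (i, n)"] assms by (simp add: InlI)
  show "W i n \<in> M \<rightarrow>\<^sub>M count_space UNIV"
    using X[of "Inr (i, n)"] assms by (simp add: InrI)
qed

lemma snapshot_measurable: "snapshot A W n \<in> M \<rightarrow>\<^sub>M count_space UNIV"
  by (intro measurable_snapshot measurable_inputs)

text \<open>
  The state at time \<open>n\<close> is a function of the coordinates up to slot \<open>n\<close> and the new input is a function of
  the coordinates of slot \<open>n + 1\<close>; disjoint blocks of an independent family are independent. The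
  observables \<open>f\<close> and \<open>g\<close> are real because \<open>indep_var\<close> relates variables with a common value type.
\<close>

lemma indep_past_slot:
  fixes f :: "('m \<Rightarrow> nat) \<times> bool \<Rightarrow> real" and g :: "('m \<Rightarrow> nat) \<times> ('m \<Rightarrow> nat) \<Rightarrow> real"
  shows "indep_var borel (\<lambda>\<omega>. f (snapshot A W n \<omega>)) borel (\<lambda>\<omega>. g (slot A W (Suc n) \<omega>))"
proof -
  define X where "X = case_sum (\<lambda>(i, n). A i n) (\<lambda>(i, n). W i n)"
  define past next_slot :: "('m \<times> nat + 'm \<times> nat) set" where
    "past = (UNIV \<times> {1..n}) <+> (UNIV \<times> {1..n})" and
    "next_slot = (UNIV \<times> {Suc n}) <+> (UNIV \<times> {Suc n})"
  \<comment> \<open>The input as coordinate functions, on which the queue recursion is run once more.\<close>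
  define a w :: "'m \<Rightarrow> nat \<Rightarrow> ('m \<times> nat + 'm \<times> nat \<Rightarrow> nat) \<Rightarrow> nat" where
    "a i k x = x (Inl (i, k))" and "w i k x = x (Inr (i, k))" for i k x
  let ?P = "\<lambda>J. PiM J (\<lambda>_. count_space (UNIV :: nat set))"
  have "indep_var (?P past) (\<lambda>\<omega>. restrict (\<lambda>j. X j \<omega>) past)
          (?P next_slot) (\<lambda>\<omega>. restrict (\<lambda>j. X j \<omega>) next_slot)"
    by (rule indep_var_restrict[OF indep[folded X_def]]) (auto simp: past_def next_slot_def)
  moreover have "f \<circ> snapshot a w n \<in> ?P past \<rightarrow>\<^sub>M borel"
    by (rule measurable_comp, rule measurable_snapshot;
        (unfold a_def w_def, rule measurable_component_singleton)?)
       (auto simp: past_def)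
  moreover have "g \<circ> slot a w (Suc n) \<in> ?P next_slot \<rightarrow>\<^sub>M borel"
    by (rule measurable_comp, rule measurable_slot;
        (unfold a_def w_def, rule measurable_component_singleton)?)
       (auto simp: next_slot_def)
  ultimately have "indep_var
      borel (f \<circ> snapshot a w n \<circ> (\<lambda>\<omega>. restrict (\<lambda>j. X j \<omega>) past))
      borel (g \<circ> slot a w (Suc n) \<circ> (\<lambda>\<omega>. restrict (\<lambda>j. X j \<omega>) next_slot))"
    by (rule indep_var_compose)
  moreover have "snapshot a w n (restrict (\<lambda>j. X j \<omega>) past) = snapshot A W n \<omega>" for \<omega>
    by (intro snapshot_cong) (simp add: slot_def a_def w_def X_def past_def InlI InrI)
  moreover have "slot a w (Suc n) (restrict (\<lambda>j. X j \<omega>) next_slot) = slot A W (Suc n) \<omega>" for \<omega>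
    by (simp add: slot_def a_def w_def X_def next_slot_def InlI InrI)
  ultimately show ?thesis
    by (simp add: comp_def)
qed

lemma slot_measurable: "slot A W (Suc n) \<in> M \<rightarrow>\<^sub>M count_space UNIV"
  by (intro measurable_slot measurable_inputs) auto

lemma pred_past [measurable]: "Measurable.pred M (\<lambda>\<omega>. f (snapshot A W n \<omega>))"
  by (rule measurable_compose[OF snapshot_measurable]) simp

lemma pred_joint: "Measurable.pred M (\<lambda>\<omega>. f (snapshot A W n \<omega>) (slot A W (Suc n) \<omega>))"
  by (rule measurable_pair_count_space[OF snapshot_measurable slot_measurable])

lemma pred_busy [measurable]: "Measurable.pred M (busy A W n)"
  using pred_past[of snd n] by (simp add: snapshot_def)

lemma expectation_of_bool: "expectation (\<lambda>\<omega>. of_bool (P \<omega>)) = prob {\<omega> \<in> space M. P \<omega>}"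
proof -
  have "expectation (\<lambda>\<omega>. of_bool (P \<omega>)) = expectation (indicator {\<omega> \<in> space M. P \<omega>})"
    by (intro Bochner_Integration.integral_cong) (auto simp: indicator_def)
  also have "\<dots> = prob {\<omega> \<in> space M. P \<omega>}"
    by (subst Bochner_Integration.integral_indicator) (auto intro!: arg_cong[where f = prob])
  finally show ?thesis .
qed

lemma integrable_of_bool:
  assumes "Measurable.pred M P"
  shows "integrable M (\<lambda>\<omega>. of_bool (P \<omega>) :: real)"
  using assms by (intro integrable_const_bound[of _ 1]) auto

lemma prob_past_slot:
  "prob {\<omega> \<in> space M. P (snapshot A W n \<omega>) \<and> R (slot A W (Suc n) \<omega>)} =
     prob {\<omega> \<in> space M. P (snapshot A W n \<omega>)} * prob {\<omega> \<in> space M. R (slot A W (Suc n) \<omega>)}"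
proof -
  have "expectation (\<lambda>\<omega>. of_bool (P (snapshot A W n \<omega>)) * of_bool (R (slot A W (Suc n) \<omega>)) :: real) =
    expectation (\<lambda>\<omega>. of_bool (P (snapshot A W n \<omega>))) * expectation (\<lambda>\<omega>. of_bool (R (slot A W (Suc n) \<omega>)))"
    by (rule indep_var_lebesgue_integral[OF
          indep_past_slot[of "\<lambda>z. of_bool (P z)" n "\<lambda>s. of_bool (R s)"]])
       (intro integrable_of_bool pred_past pred_joint[of "\<lambda>_. R"])+
  then show ?thesis
    by (simp add: expectation_of_bool flip: of_bool_conj)
qed

lemma prob_only_i_transmits:
  assumes "1 \<le> n"
  shows "prob {\<omega> \<in> space M. W i n \<omega> = 1 \<and> (\<forall>j. j \<noteq> i \<longrightarrow> W j n \<omega> = 0)} = success_rate p i"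
proof -
  define X where "X = case_sum (\<lambda>(i, n). A i n) (\<lambda>(i, n). W i n)"
  define J :: "('m \<times> nat + 'm \<times> nat) set" where "J = range (\<lambda>j. Inr (j, n))"
  \<comment> \<open>The transmission pattern prescribed to each coin of the slot.\<close>
  define w :: "'m \<times> nat + 'm \<times> nat \<Rightarrow> nat set" where "w k = (if k = Inr (i, n) then {1} else {0})" for k
  have one: "prob (W j n -` {1} \<inter> space M) = p $ j" for j
    using W_law[OF assms, of j] by (simp add: vimage_def Int_def conj_commute)
  have zero: "prob (W j n -` {0} \<inter> space M) = 1 - p $ j" for j
  proof -
    have "W j n -` {0} \<inter> space M = space M - (W j n -` {1} \<inter> space M)"
      using W_range[OF assms] by fastforce
    moreover have "W j n -` {1} \<inter> space M \<in> events"
      by (rule measurable_sets[OF measurable_inputs(2)[OF assms]]) simp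
    ultimately show ?thesis
      by (simp only: prob_compl one)
  qed
  have "prob (\<Inter>k\<in>J. X k -` w k \<inter> space M) = (\<Prod>k\<in>J. prob (X k -` w k \<inter> space M))"
    by (rule indep_varsD[OF indep[folded X_def]]) (use assms in \<open>auto simp: J_def\<close>)
  also have "(\<Inter>k\<in>J. X k -` w k \<inter> space M)
      = {\<omega> \<in> space M. W i n \<omega> = 1 \<and> (\<forall>j. j \<noteq> i \<longrightarrow> W j n \<omega> = 0)}"
    by (auto simp: J_def X_def w_def split: if_splits)
  also have "(\<Prod>k\<in>J. prob (X k -` w k \<inter> space M)) =
      (\<Prod>j\<in>UNIV. prob (X (Inr (j, n)) -` w (Inr (j, n)) \<inter> space M))"
    unfolding J_def by (subst prod.reindex) (auto simp: inj_on_def)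
  also have "\<dots> = p $ i * (\<Prod>j\<in>UNIV - {i}. prob (X (Inr (j, n)) -` w (Inr (j, n)) \<inter> space M))"
    by (subst prod.remove[of _ i]) (auto simp: X_def w_def one[simplified])
  also have "\<dots> = success_rate p i"
    unfolding success_rate_def by (intro arg_cong2[where f = "(*)"] prod.cong) 
      (auto simp: X_def w_def zero)
  finally show ?thesis .
qed

section \<open>Arrivals and departures during the busy period\<close>

lemma W_le_1: "1 \<le> n \<Longrightarrow> \<omega> \<in> space M \<Longrightarrow> W i n \<omega> \<le> 1"
  using W_range[of n \<omega> i] by auto

lemma queue_balance:
  assumes "\<omega> \<in> space M"
  shows "queue0 A W (Suc n) \<omega> i + of_bool (success (queue0 A W n \<omega>) (\<lambda>i. W i (Suc n) \<omega>) i)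
    = queue0 A W n \<omega> i + A i (Suc n) \<omega>"
  unfolding queue.simps by (rule aloha_step_balance) (rule W_le_1[OF _ assms], simp)

text \<open>
  If queue \<open>i\<close> is nonempty, its user transmits and all others stay silent, then the transmission succeeds.
  This pattern of coins has probability \<open>success_rate p i\<close> and is independent of the past. The inequality
  can be strict, since users with empty queues do not disturb even when their coin shows \<open>1\<close>.
\<close>

lemma prob_busy_success_ge:
  "prob {\<omega> \<in> space M. busy A W n \<omega> \<and> queue0 A W n \<omega> i \<noteq> 0} * success_rate p i
    \<le> prob {\<omega> \<in> space M. busy A W n \<omega> \<and> success (queue0 A W n \<omega>) (\<lambda>i. W i (Suc n) \<omega>) i}"
  (is "?lhs \<le> prob ?S")
proof -
  have "?lhs = prob {\<omega> \<in> space M. (busy A W n \<omega> \<and> queue0 A W n \<omega> i \<noteq> 0) \<and>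
      W i (Suc n) \<omega> = 1 \<and> (\<forall>j. j \<noteq> i \<longrightarrow> W j (Suc n) \<omega> = 0)}"
    using prob_past_slot[of "\<lambda>(q, b). b \<and> q i \<noteq> 0" n "\<lambda>(a, w). w i = 1 \<and> (\<forall>j. j \<noteq> i \<longrightarrow> w j = 0)"]
    by (simp add: snapshot_def slot_def prob_only_i_transmits[simplified])
  also have "\<dots> \<le> prob ?S"
  proof (rule finite_measure_mono)
    show "?S \<in> events"
      using pred_joint[of "\<lambda>z s. snd z \<and> success (fst z) (snd s) i" n]
      unfolding snapshot_def slot_def fst_conv snd_conv pred_def .
  qed (auto simp: success_def attempts_def)
  finally show ?thesis .
qed

context
  fixes lam :: "real ^ 'm"
  assumes laws: "arrival_laws lam d"
begin

lemma integrable_arrival: "integrable M (\<lambda>\<omega>. real (A i (Suc n) \<omega>))"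
  and expectation_arrival: "expectation (\<lambda>\<omega>. real (A i (Suc n) \<omega>)) = lam $ i"
proof -
  note A = measurable_inputs(1)[of "Suc n" i, simplified]
  have d: "integrable (distr M (count_space UNIV) (A i (Suc n))) real"
    using laws by (simp add: A_law arrival_laws_def)
  then show "integrable M (\<lambda>\<omega>. real (A i (Suc n) \<omega>))"
    by (simp add: integrable_distr_eq[OF A])
  have "expectation (\<lambda>\<omega>. real (A i (Suc n) \<omega>)) = integral\<^sup>L (distr M (count_space UNIV) (A i (Suc n))) real"
    by (rule integral_distr[OF A, symmetric]) simp
  then show "expectation (\<lambda>\<omega>. real (A i (Suc n) \<omega>)) = lam $ i"
    using laws by (simp add: A_law arrival_laws_def)
qed

text \<open>
  Wald's identity, one slot at a time: whether the return has occurred by slot \<open>n\<close> is decided before the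
  arrivals of slot \<open>n + 1\<close>.
\<close>

lemma integrable_busy_arrival: "integrable M (\<lambda>\<omega>. of_bool (busy A W n \<omega>) * real (A i (Suc n) \<omega>))"
  and expectation_busy_arrival:
    "expectation (\<lambda>\<omega>. of_bool (busy A W n \<omega>) * real (A i (Suc n) \<omega>))
      = prob {\<omega> \<in> space M. busy A W n \<omega>} * lam $ i"
proof -
  have ind: "indep_var borel (\<lambda>\<omega>. of_bool (busy A W n \<omega>)) borel (\<lambda>\<omega>. real (A i (Suc n) \<omega>))"
    using indep_past_slot[of "\<lambda>z. of_bool (snd z)" n "\<lambda>s. real (fst s i)"]
    by (simp add: snapshot_def slot_def)
  note int = integrable_of_bool[OF pred_busy, of n] integrable_arrival[of i n]
  show "integrable M (\<lambda>\<omega>. of_bool (busy A W n \<omega>) * real (A i (Suc n) \<omega>))"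
    by (rule indep_var_integrable[OF ind int])
  show "expectation (\<lambda>\<omega>. of_bool (busy A W n \<omega>) * real (A i (Suc n) \<omega>))
      = prob {\<omega> \<in> space M. busy A W n \<omega>} * lam $ i"
    using indep_var_lebesgue_integral[OF ind int]
    by (simp add: expectation_of_bool expectation_arrival)
qed

lemma borel_measurable_queue [measurable]: "(\<lambda>\<omega>. real (queue0 A W n \<omega> i)) \<in> borel_measurable M"
  using measurable_compose[OF snapshot_measurable, of "\<lambda>z. real (fst z i)" borel n]
  by (simp add: snapshot_def)

lemma integrable_queue: "integrable M (\<lambda>\<omega>. real (queue0 A W n \<omega> i))"
proof (induction n)
  case (Suc n)
  show ?case
  proof (rule Bochner_Integration.integrable_bound)
    show "integrable M (\<lambda>\<omega>. real (queue0 A W n \<omega> i) + real (A i (Suc n) \<omega>))"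
      by (intro Bochner_Integration.integrable_add Suc.IH integrable_arrival)
    show "AE \<omega> in M. norm (real (queue0 A W (Suc n) \<omega> i))
        \<le> norm (real (queue0 A W n \<omega> i) + real (A i (Suc n) \<omega>))"
    proof (rule AE_I2)
      fix \<omega> assume "\<omega> \<in> space M"
      from queue_balance[OF this, of n i]
      have "queue0 A W (Suc n) \<omega> i \<le> queue0 A W n \<omega> i + A i (Suc n) \<omega>"
        by linarith
      then show "norm (real (queue0 A W (Suc n) \<omega> i))
          \<le> norm (real (queue0 A W n \<omega> i) + real (A i (Suc n) \<omega>))"
        by (simp del: queue.simps)
    qed
  qed (rule borel_measurable_queue)
qed simp

lemma integrable_busy_queue:
  "integrable M (\<lambda>\<omega>. of_bool (busy A W n \<omega>) * real (queue0 A W n \<omega> i))"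
proof (rule Bochner_Integration.integrable_bound[OF integrable_queue[of n i]])
  show "(\<lambda>\<omega>. of_bool (busy A W n \<omega>) * real (queue0 A W n \<omega> i)) \<in> borel_measurable M"
    using integrable_of_bool[OF pred_busy, of n]
    by (intro borel_measurable_times borel_measurable_queue borel_measurable_integrable)
qed simp

section \<open>Negative drift and positive recurrence\<close>

text \<open>
  The mean queue length on the event that the origin has not been revisited, that is, for the chain killed
  at its return.
\<close>

definition load :: "nat \<Rightarrow> 'm \<Rightarrow> real" where
  "load n i = expectation (\<lambda>\<omega>. of_bool (busy A W n \<omega>) * real (queue0 A W n \<omega> i))"

lemma load_nonneg: "0 \<le> load n i"
  unfolding load_def by (intro Bochner_Integration.integral_nonneg) simp

lemma load_0: "load 0 i = 0"
  by (simp add: load_def)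

text \<open>
  The drift of one queue. Passing from \<open>busy n\<close> to the smaller event \<open>busy (n + 1)\<close> loses nothing, because
  the chain is killed exactly when all queues are empty; the inequality comes from the lower bound on
  successful transmissions.
\<close>

lemma load_Suc_le:
  "load (Suc n) i + prob {\<omega> \<in> space M. busy A W n \<omega> \<and> queue0 A W n \<omega> i \<noteq> 0} * success_rate p i
    \<le> load n i + prob {\<omega> \<in> space M. busy A W n \<omega>} * lam $ i"
proof -
  let ?S = "\<lambda>\<omega>. busy A W n \<omega> \<and> success (queue0 A W n \<omega>) (\<lambda>i. W i (Suc n) \<omega>) i"
  have S: "Measurable.pred M ?S"
    using pred_joint[of "\<lambda>z s. snd z \<and> success (fst z) (snd s) i" n]
    unfolding snapshot_def slot_def fst_conv snd_conv .
  note int = integrable_busy_queue integrable_of_bool[OF S] integrable_busy_arrival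
  have "load (Suc n) i + prob {\<omega> \<in> space M. ?S \<omega>} = expectation (\<lambda>\<omega>.
      of_bool (busy A W (Suc n) \<omega>) * real (queue0 A W (Suc n) \<omega> i) + of_bool (?S \<omega>))"
    using Bochner_Integration.integral_add[OF int(1)[of "Suc n" i] int(2)]
    unfolding load_def expectation_of_bool by (rule sym)
  also have "\<dots> \<le> expectation (\<lambda>\<omega>.
      of_bool (busy A W n \<omega>) * real (queue0 A W n \<omega> i) + of_bool (busy A W n \<omega>) * real (A i (Suc n) \<omega>))"
  proof (rule integral_mono)
    fix \<omega> assume "\<omega> \<in> space M"
    from arg_cong[OF queue_balance[OF this, of n i], of real]
    have "real (queue0 A W (Suc n) \<omega> i) + of_bool (success (queue0 A W n \<omega>) (\<lambda>i. W i (Suc n) \<omega>) i)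
        = real (queue0 A W n \<omega> i) + real (A i (Suc n) \<omega>)"
      by (simp only: of_nat_add of_nat_of_bool)
    then show "of_bool (busy A W (Suc n) \<omega>) * real (queue0 A W (Suc n) \<omega> i) + of_bool (?S \<omega>)
        \<le> of_bool (busy A W n \<omega>) * real (queue0 A W n \<omega> i)
          + of_bool (busy A W n \<omega>) * real (A i (Suc n) \<omega>)"
      by (cases "busy A W n \<omega>"; cases "busy A W (Suc n) \<omega>")
         (simp_all add: busy_Suc del: queue.simps)
  qed (rule Bochner_Integration.integrable_add; rule int)+
  also have "\<dots> = load n i + prob {\<omega> \<in> space M. busy A W n \<omega>} * lam $ i"
    using Bochner_Integration.integral_add[OF int(1)[of n i] int(3)[of n i]]
    unfolding load_def expectation_busy_arrival .
  finally show ?thesis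
    using prob_busy_success_ge[of n i] by linarith
qed

lemma prob_busy_le_sum:
  assumes "1 \<le> n"
  shows "prob {\<omega> \<in> space M. busy A W n \<omega>}
    \<le> (\<Sum>i\<in>UNIV. prob {\<omega> \<in> space M. busy A W n \<omega> \<and> queue0 A W n \<omega> i \<noteq> 0})"
proof -
  have "busy A W n \<omega> \<longleftrightarrow> (\<exists>i. busy A W n \<omega> \<and> queue0 A W n \<omega> i \<noteq> 0)" for \<omega>
    using busy_nonzero[of A W n \<omega>, OF _ assms] by (cases "busy A W n \<omega>") simp_all
  then have "{\<omega> \<in> space M. busy A W n \<omega>}
      = {\<omega> \<in> space M. \<exists>i. busy A W n \<omega> \<and> queue0 A W n \<omega> i \<noteq> 0}"
    by (rule arg_cong[where f = "\<lambda>P. {\<omega> \<in> space M. P \<omega>}", OF ext])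
  also have "\<dots> = (\<Union>i. {\<omega> \<in> space M. busy A W n \<omega> \<and> queue0 A W n \<omega> i \<noteq> 0})"
    by auto
  finally have "{\<omega> \<in> space M. busy A W n \<omega>}
      = (\<Union>i. {\<omega> \<in> space M. busy A W n \<omega> \<and> queue0 A W n \<omega> i \<noteq> 0})" .
  moreover have "{\<omega> \<in> space M. busy A W n \<omega> \<and> queue0 A W n \<omega> i \<noteq> 0} \<in> events" for i
    using pred_past[of "\<lambda>z. snd z \<and> fst z i \<noteq> 0" n]
    unfolding snapshot_def fst_conv snd_conv pred_def .
  ultimately show ?thesis
    by (simp only:) (rule finite_measure_subadditive_finite, auto)
qed

lemma success_rate_pos: "p \<in> unit_cube \<Longrightarrow> 0 < success_rate p i"
  unfolding success_rate_def unit_cube_def by (auto intro!: mult_pos_pos prod_pos)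

text \<open>
  Foster's argument for the Lyapunov function \<open>V\<close>, the sum of the queue lengths divided by the success
  rates. For \<open>n \<ge> 1\<close> a chain that is still busy has a nonempty queue, so the drift is at most
  \<open>(\<rho> - 1) * b n\<close>. At \<open>n = 0\<close> the chain sits at the origin and \<open>V\<close> may rise to \<open>\<rho> = 1 - (1 - \<rho>) * b 0\<close>; this
  starts the invariant \<open>V (n + 1) + (1 - \<rho>) * (b 0 + \<dots> + b n) \<le> 1\<close>.
\<close>

lemma sum_prob_busy_le:
  fixes N :: nat
  assumes p: "p \<in> unit_cube"
  defines "\<rho> \<equiv> \<Sum>i\<in>UNIV. lam $ i / success_rate p i"
  assumes \<rho>: "\<rho> < 1"
  shows "(\<Sum>n<N. prob {\<omega> \<in> space M. busy A W n \<omega>}) \<le> 1 / (1 - \<rho>)"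
proof -
  define b where "b n = prob {\<omega> \<in> space M. busy A W n \<omega>}" for n
  define b' where "b' n i = prob {\<omega> \<in> space M. busy A W n \<omega> \<and> queue0 A W n \<omega> i \<noteq> 0}" for n i
  define V where "V n = (\<Sum>i\<in>UNIV. load n i / success_rate p i)" for n
  note s_pos = success_rate_pos[OF p]
  have V_Suc: "V (Suc n) + (\<Sum>i\<in>UNIV. b' n i) \<le> V n + b n * \<rho>" for n
  proof -
    have "V (Suc n) + (\<Sum>i\<in>UNIV. b' n i)
        = (\<Sum>i\<in>UNIV. (load (Suc n) i + b' n i * success_rate p i) / success_rate p i)"
      unfolding V_def sum.distrib[symmetric]
      using s_pos by (intro sum.cong) (simp_all add: add_divide_distrib less_imp_neq[symmetric])
    also have "\<dots> \<le> (\<Sum>i\<in>UNIV. (load n i + b n * lam $ i) / success_rate p i)"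
      using load_Suc_le[of n] s_pos unfolding b_def b'_def
      by (intro sum_mono divide_right_mono) (auto intro: less_imp_le)
    also have "\<dots> = V n + b n * \<rho>"
      unfolding V_def \<rho>_def by (simp add: add_divide_distrib sum.distrib sum_distrib_left)
    finally show ?thesis .
  qed
  have V_nonneg: "0 \<le> V n" for n
    unfolding V_def using s_pos by (intro sum_nonneg divide_nonneg_pos load_nonneg) auto
  have "V (Suc n) + (1 - \<rho>) * (\<Sum>k<Suc n. b k) \<le> 1" for n
  proof (induction n)
    case 0
    have "0 \<le> (\<Sum>i\<in>UNIV. b' 0 i)"
      unfolding b'_def by (intro sum_nonneg) simp
    moreover have "b 0 = 1" "V 0 = 0"
      by (simp_all add: b_def busy_0 V_def load_0 prob_space)
    ultimately show ?case
      using V_Suc[of 0] by simp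
  next
    case (Suc n)
    have "b (Suc n) \<le> (\<Sum>i\<in>UNIV. b' (Suc n) i)"
      unfolding b_def b'_def by (rule prob_busy_le_sum) simp
    with V_Suc[of "Suc n"] Suc.IH show ?case
      by (simp add: algebra_simps)
  qed
  from this[of N] V_nonneg[of "Suc N"] have "(1 - \<rho>) * (\<Sum>k<Suc N. b k) \<le> 1"
    by linarith
  moreover have "(1 - \<rho>) * (\<Sum>k<N. b k) \<le> (1 - \<rho>) * (\<Sum>k<Suc N. b k)"
    using \<rho> by (intro mult_left_mono) (simp_all add: b_def)
  ultimately have "(1 - \<rho>) * (\<Sum>k<N. b k) \<le> 1"
    by linarith
  then show ?thesis
    using \<rho> unfolding b_def by (simp add: field_simps)
qed

lemma expected_return_time:
  "(\<integral>\<^sup>+ \<omega>. return_time A W \<omega> \<partial>M) = (\<Sum>n. ennreal (prob {\<omega> \<in> space M. busy A W n \<omega>}))"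
proof -
  have of_bool: "(of_bool (busy A W n \<omega>) :: ennreal) = indicator {\<omega> \<in> space M. busy A W n \<omega>} \<omega>"
    if "\<omega> \<in> space M" for n \<omega>
    using that by (simp add: indicator_def)
  have ev: "{\<omega> \<in> space M. busy A W n \<omega>} \<in> events" for n
    using pred_busy[of n] unfolding pred_def .
  have "(\<integral>\<^sup>+ \<omega>. return_time A W \<omega> \<partial>M)
      = (\<integral>\<^sup>+ \<omega>. (\<Sum>n. indicator {\<omega> \<in> space M. busy A W n \<omega>} \<omega>) \<partial>M)"
    by (intro nn_integral_cong) (simp add: return_time_eq_suminf of_bool)
  also have "\<dots> = (\<Sum>n. \<integral>\<^sup>+ \<omega>. indicator {\<omega> \<in> space M. busy A W n \<omega>} \<omega> \<partial>M)"
    using ev by (intro nn_integral_suminf) simp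
  also have "\<dots> = (\<Sum>n. ennreal (prob {\<omega> \<in> space M. busy A W n \<omega>}))"
    by (simp only: nn_integral_indicator[OF ev] emeasure_eq_measure)
  finally show ?thesis .
qed

theorem positive_recurrent_if_drift:
  assumes "p \<in> unit_cube" "(\<Sum>i\<in>UNIV. lam $ i / success_rate p i) < 1"
  shows "positive_recurrent M A W"
proof -
  define \<rho> where "\<rho> = (\<Sum>i\<in>UNIV. lam $ i / success_rate p i)"
  have "(\<integral>\<^sup>+ \<omega>. return_time A W \<omega> \<partial>M) \<le> ennreal (1 / (1 - \<rho>))"
    unfolding expected_return_time \<rho>_def
  proof (rule suminf_le_const)
    show "(\<Sum>n<N. ennreal (prob {\<omega> \<in> space M. busy A W n \<omega>}))
        \<le> ennreal (1 / (1 - (\<Sum>i\<in>UNIV. lam $ i / success_rate p i)))" for N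
      by (subst sum_ennreal) (simp, rule ennreal_leI, rule sum_prob_busy_le[OF assms])
  qed simp
  also have "\<dots> < \<infinity>"
    by simp
  finally show ?thesis
    unfolding positive_recurrent_def .
qed

section \<open>Wald's identity and the bound on the arrival rates\<close>

text \<open>
  At most one departure per slot; the initial state is empty.
\<close>

lemma arrivals_le_queue:
  assumes "\<omega> \<in> space M"
  shows "(\<Sum>k<n. A i (Suc k) \<omega>) \<le> queue0 A W n \<omega> i + n"
proof (induction n)
  case (Suc n)
  have "of_bool (success (queue0 A W n \<omega>) (\<lambda>i. W i (Suc n) \<omega>) i) \<le> (1 :: nat)"
    by simp
  with Suc.IH queue_balance[OF assms, of n i] show ?case
    unfolding sum.lessThan_Suc by linarith
qed simp

text \<open>
  The sum counts the packets that reach user \<open>i\<close> up to the return time \<open>T\<close>. All of them have left by \<open>T\<close>, in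
  different slots. If \<open>T = \<infinity>\<close>, the bound is trivial, so it holds surely.
\<close>

lemma busy_arrivals_le_return_time:
  assumes "\<omega> \<in> space M"
  shows "(\<Sum>k. ennreal (of_bool (busy A W k \<omega>) * real (A i (Suc k) \<omega>))) \<le> return_time A W \<omega>"
proof (cases "\<forall>n. busy A W n \<omega>")
  case True
  then have "return_time A W \<omega> = \<infinity>"
    by (simp add: return_time_eq_suminf suminf_eq_SUP ennreal_SUP_of_nat_eq_top)
  then show ?thesis
    by simp
next
  case False
  then obtain n where "\<not> busy A W n \<omega>"
    by blast
  from busy_until[OF this] obtain t
    where t: "\<forall>i. queue0 A W t \<omega> i = 0" "\<And>k. busy A W k \<omega> \<longleftrightarrow> k < t"
    by blast
  have "(\<Sum>k. ennreal (of_bool (busy A W k \<omega>) * real (A i (Suc k) \<omega>)))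
      = (\<Sum>k<t. ennreal (of_bool (busy A W k \<omega>) * real (A i (Suc k) \<omega>)))"
    by (rule suminf_finite) (simp_all add: t(2))
  also have "\<dots> = ennreal (real (\<Sum>k<t. A i (Suc k) \<omega>))"
    by (simp add: t(2))
  also have "\<dots> \<le> ennreal (real t)"
    using arrivals_le_queue[OF assms, of i t] t(1) by (intro ennreal_leI of_nat_mono) simp
  also have "\<dots> = (\<Sum>k<t. of_bool (busy A W k \<omega>))"
    by (simp add: t(2) ennreal_of_nat_eq_real_of_nat)
  also have "\<dots> = return_time A W \<omega>"
    unfolding return_time_eq_suminf by (rule suminf_finite[symmetric]) (simp_all add: t(2))
  finally show ?thesis .
qed

theorem mean_le_1_if_positive_recurrent:
  assumes "positive_recurrent M A W"
  shows "lam $ i \<le> 1"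
proof -
  define b where "b n = prob {\<omega> \<in> space M. busy A W n \<omega>}" for n
  let ?T = "\<integral>\<^sup>+ \<omega>. return_time A W \<omega> \<partial>M"
  have fin: "?T < \<infinity>"
    using assms unfolding positive_recurrent_def .
  have T: "?T = (\<Sum>n. ennreal (b n))"
    unfolding b_def by (rule expected_return_time)
  have lam: "0 \<le> lam $ i"
    unfolding expectation_arrival[of i 0, symmetric] by (rule Bochner_Integration.integral_nonneg) simp
  have "ennreal (b n) * ennreal (lam $ i)
      = (\<integral>\<^sup>+ \<omega>. ennreal (of_bool (busy A W n \<omega>) * real (A i (Suc n) \<omega>)) \<partial>M)" for n
    using lam by (subst nn_integral_eq_integral[OF integrable_busy_arrival])
      (simp_all add: expectation_busy_arrival b_def ennreal_mult)
  then have "?T * ennreal (lam $ i)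
      = (\<Sum>n. \<integral>\<^sup>+ \<omega>. ennreal (of_bool (busy A W n \<omega>) * real (A i (Suc n) \<omega>)) \<partial>M)"
    unfolding T ennreal_suminf_multc[symmetric] by (rule suminf_cong)
  also have "\<dots> = (\<integral>\<^sup>+ \<omega>. (\<Sum>n. ennreal (of_bool (busy A W n \<omega>) * real (A i (Suc n) \<omega>))) \<partial>M)"
    using borel_measurable_integrable[OF integrable_busy_arrival]
    by (intro nn_integral_suminf[symmetric]) (rule measurable_compose[OF _ measurable_ennreal])
  also have "\<dots> \<le> ?T"
    by (intro nn_integral_mono busy_arrivals_le_return_time)
  finally have le: "?T * ennreal (lam $ i) \<le> ?T" .
  have "ennreal (b 0) \<le> ?T"
    unfolding T using sum_le_suminf[of "\<lambda>n. ennreal (b n)" "{0}"] by simp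
  moreover have "b 0 = 1"
    by (simp add: b_def busy_0 prob_space)
  ultimately have ge: "1 \<le> ?T"
    by simp
  from fin obtain t where t: "?T = ennreal t" "0 \<le> t"
    by (cases ?T) auto
  from ge have "1 \<le> t"
    using t by (simp flip: ennreal_1)
  moreover from le have "t * lam $ i \<le> t"
    using t lam by (simp flip: ennreal_mult)
  ultimately show ?thesis
    by simp
qed

end

end

section \<open>The unit cube and its closure\<close>

text \<open>
  Bernoulli arrivals realise every mean vector in the open cube.
\<close>

lemma admissible_mean_unit_cube:
  fixes lam :: "real ^ 'm::finite"
  assumes "lam \<in> unit_cube"
  shows "admissible_mean lam"
proof -
  have lam: "0 < lam $ i" "lam $ i < 1" for i
    using assms by (auto simp: unit_cube_def)
  define d :: "'m \<Rightarrow> nat pmf" where "d i = map_pmf of_bool (bernoulli_pmf (lam $ i))" for i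
  have "arrival_laws lam d"
    unfolding arrival_laws_def
  proof (intro allI conjI)
    fix i
    show "integrable (measure_pmf (d i)) real"
      by (rule integrable_measure_pmf_finite) (simp add: d_def)
    show "measure_pmf.expectation (d i) real = lam $ i"
      using lam[of i] by (simp add: d_def less_imp_le)
    have "1 \<in> set_pmf (d i)"
      using lam[of i] by (force simp: d_def set_pmf_bernoulli)
    then show "0 < pmf (d i) 1"
      by (simp add: pmf_positive)
  qed
  with lam show ?thesis
    unfolding admissible_mean_def by blast
qed

text \<open>
  User \<open>i\<close> transmits with probability \<open>c\<close> and each other user with probability \<open>1 - c\<close>. All factors of the
  success rate of \<open>i\<close> then equal \<open>c\<close>, so it is \<open>c\<close> to the number of users, which takes every
  value in \<open>(0, 1)\<close>.
\<close>

lemma C2_eq_unit_cube: "C2 = (unit_cube :: (real ^ 'm::finite) set)"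
proof
  show "C2 \<subseteq> (unit_cube :: (real ^ 'm) set)"
    by (auto simp: C2_def C2_at_def)
  show "unit_cube \<subseteq> (C2 :: (real ^ 'm) set)"
  proof
    fix lam :: "real ^ 'm"
    assume lam: "lam \<in> unit_cube"
    fix i :: 'm
    define y where "y = (1 + lam $ i) / 2"
    have y: "lam $ i < y" "0 < y" "y < 1"
      using lam by (auto simp: y_def unit_cube_def field_simps intro: add_pos_pos)
    define c where "c = root CARD('m) y"
    have c: "0 < c" "c < 1" "c ^ CARD('m) = y"
      using y by (simp_all add: c_def)
    define p :: "real ^ 'm" where "p = (\<chi> j. if j = i then c else 1 - c)"
    have "p \<in> unit_cube"
      using c by (simp add: p_def unit_cube_def)
    moreover have "success_rate p i = y"
    proof -
      have "success_rate p i = c * (\<Prod>j\<in>UNIV - {i}. c)"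
        unfolding success_rate_def by (intro arg_cong2[where f = "(*)"] prod.cong) (auto simp: p_def)
      also have "\<dots> = (\<Prod>j\<in>(UNIV :: 'm set). c)"
        by (rule prod.remove[symmetric]) auto
      finally show ?thesis
        using c by simp
    qed
    ultimately show "lam \<in> C2"
      using lam y unfolding C2_def C2_at_def by auto
  qed
qed

text \<open>
  Shrink towards the origin.
\<close>

lemma closure_unit_cube:
  fixes lam :: "real ^ 'm::finite"
  assumes "\<And>i. 0 < lam $ i" "\<And>i. lam $ i \<le> 1"
  shows "lam \<in> closure unit_cube"
  unfolding closure_sequential
proof (intro exI conjI allI)
  let ?x = "\<lambda>n. (1 - inverse (real (Suc (Suc n)))) *\<^sub>R lam"
  fix n
  \<comment> \<open>The index is shifted by two to keep the factor positive at \<open>n = 0\<close>.\<close>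
  have c: "0 < 1 - inverse (real (Suc (Suc n)))" "1 - inverse (real (Suc (Suc n))) < 1"
    by (simp_all add: field_simps)
  have "(1 - inverse (real (Suc (Suc n)))) * lam $ i < 1" for i
    using mult_strict_right_mono[OF c(2) assms(1)[of i]] assms(2)[of i] by linarith
  with c(1) assms(1) show "?x n \<in> unit_cube"
    by (simp add: unit_cube_def del: of_nat_Suc)
next
  let ?x = "\<lambda>n. (1 - inverse (real (Suc (Suc n)))) *\<^sub>R lam"
  have "?x \<longlonglongrightarrow> (1 - 0) *\<^sub>R lam"
    by (intro tendsto_intros LIMSEQ_Suc[OF LIMSEQ_inverse_real_of_nat])
  then show "?x \<longlonglongrightarrow> lam"
    by simp
qed

theorem corollary1:
  fixes D :: "real ^ 'm::finite \<Rightarrow> 'm \<Rightarrow> nat pmf"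
    and M :: "real ^ 'm \<Rightarrow> real ^ 'm \<Rightarrow> 'w measure"
    and A W :: "real ^ 'm \<Rightarrow> real ^ 'm \<Rightarrow> 'm \<Rightarrow> nat \<Rightarrow> 'w \<Rightarrow> nat"
  assumes "\<And>lam. admissible_mean lam \<Longrightarrow> arrival_laws lam (D lam)"
    and "\<And>lam p. admissible_mean lam \<Longrightarrow> p \<in> unit_cube \<Longrightarrow>
           aloha_inputs (M lam p) (A lam p) (W lam p) (D lam) p"
  shows "C1 \<subseteq> recurrence_region M A W \<and> recurrence_region M A W \<subseteq> closure C2"
proof (intro conjI subsetI)
  fix lam :: "real ^ 'm"
  assume "lam \<in> C1"
  then obtain p where p: "p \<in> unit_cube" "(\<Sum>i\<in>UNIV. lam $ i / success_rate p i) < 1"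
    and lam: "lam \<in> unit_cube"
    unfolding C1_def C1_at_def by blast
  note adm = admissible_mean_unit_cube[OF lam]
  have "positive_recurrent (M lam p) (A lam p) (W lam p)"
    by (rule aloha_inputs.positive_recurrent_if_drift[OF assms(2)[OF adm p(1)] assms(1)[OF adm] p])
  with adm p(1) show "lam \<in> recurrence_region M A W"
    unfolding recurrence_region_def by blast
next
  fix lam :: "real ^ 'm"
  assume "lam \<in> recurrence_region M A W"
  then obtain p where adm: "admissible_mean lam" and p: "p \<in> unit_cube"
    and rec: "positive_recurrent (M lam p) (A lam p) (W lam p)"
    unfolding recurrence_region_def by blast
  have "lam $ i \<le> 1" for i
    by (rule aloha_inputs.mean_le_1_if_positive_recurrent[OF assms(2)[OF adm p] assms(1)[OF adm] rec])
  with adm show "lam \<in> closure C2"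
    unfolding C2_eq_unit_cube admissible_mean_def by (intro closure_unit_cube) auto
qed

end
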